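(* (Soundness) Every sequent $\Gamma\Rightarrow\Sigma$ derivable in the sequent calculus $\mathfrak S$ is valid.
   Context: Formulas are built from a denumerable set of propositional variables with binary $\wedge,\vee$, unary $\neg,\nabla$ and constants $\bot,\top$. $\mathbb{S}_6$ is the algebra with universe $\{0,\tfrac13,N,B,\tfrac23,1\}$, lattice order $0<\tfrac13<N<\tfrac23<1$, $\tfrac13<B<\tfrac23$, $N,B$ incomparable; $\neg$ swaps $0\leftrightarrow1$, $\tfrac13\leftrightarrow\tfrac23$, fixes $N,B$; $\nabla0=0$, $\nabla x=1$ for $x\ne0$; homomorphisms from formulas send $\bot\mapsto0,\top\mapsto1$. A sequent is $\Gamma\Rightarrow\Sigma$ with $\Gamma,\Sigma$ finite sets of formulas; it is valid iff $h(\bigwedge\Gamma)\le h(\bigvee\Sigma)$ for every homomorphism $h$ into $\mathbb{S}_6$ (empty conjunction $\top$, empty disjunction $\bot$). For a set $\Sigma$, $\nabla\Sigma=\{\nabla\beta:\beta\in\Sigma\}$. The calculus $\mathfrak S$ has axioms $\alpha\Rightarrow\alpha$; $\bot\Rightarrow$; $\Rightarrow\top$; $\alpha\Rightarrow\nabla\alpha$; $\Rightarrow\nabla\alpha\vee\neg\nabla\alpha$; and rules (premises / conclusion): left weakening $\Gamma\Rightarrow\Sigma$ / $\Gamma,\alpha\Rightarrow\Sigma$; right weakening $\Gamma\Rightarrow\Sigma$ / $\Gamma\Rightarrow\Sigma,\alpha$; cut $\Gamma\Rightarrow\Sigma,\alpha$ and $\alpha,\Gamma\Rightarrow\Sigma$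 / $\Gamma\Rightarrow\Sigma$; $(\wedge\Rightarrow)$ $\Gamma,\alpha,\beta\Rightarrow\Sigma$ / $\Gamma,\alpha\wedge\beta\Rightarrow\Sigma$; $(\Rightarrow\wedge)$ $\Gamma\Rightarrow\Sigma,\alpha$ and $\Gamma\Rightarrow\Sigma,\beta$ / $\Gamma\Rightarrow\Sigma,\alpha\wedge\beta$; $(\vee\Rightarrow)$ $\Gamma,\alpha\Rightarrow\Sigma$ and $\Gamma,\beta\Rightarrow\Sigma$ / $\Gamma,\alpha\vee\beta\Rightarrow\Sigma$; $(\Rightarrow\vee)$ $\Gamma\Rightarrow\Sigma,\alpha,\beta$ / $\Gamma\Rightarrow\Sigma,\alpha\vee\beta$; $(\neg)$ $\alpha\Rightarrow\beta$ / $\neg\beta\Rightarrow\neg\alpha$; $(\neg\neg\Rightarrow)$ $\Gamma,\alpha\Rightarrow\Sigma$ / $\Gamma,\neg\neg\alpha\Rightarrow\Sigma$; $(\Rightarrow\neg\neg)$ $\Gamma\Rightarrow\alpha,\Sigma$ / $\Gamma\Rightarrow\neg\neg\alpha,\Sigma$; $(\nabla)$ $\Gamma,\alpha\Rightarrow\nabla\Sigma$ / $\Gamma,\nabla\alpha\Rightarrow\nabla\Sigma$; $(\neg\nabla\Rightarrow)$ $\Gamma,\neg\nabla\alpha\Rightarrow\Sigma$ / $\Gamma,\nabla\neg\nabla\alpha\Rightarrow\Sigma$. Derivability is the usual notion (derivation trees from axiom instances using these rules). *)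

theory Defs
  imports "HOL-Library.FSet"
begin

datatype fm =
    Var nat
  | Bot (\<open>\<^bold>\<bottom>\<close>)
  | Top (\<open>\<^bold>\<top>\<close>)
  | Neg fm (\<open>\<^bold>\<not> _\<close> [70] 70)
  | Nabla fm (\<open>\<^bold>\<nabla> _\<close> [70] 70)
  | And fm fm (infixr \<open>\<^bold>\<and>\<close> 65)
  | Or fm fm (infixr \<open>\<^bold>\<or>\<close> 60)

datatype S6 = Zero | Third | N | B | TwoThirds | One

instantiation S6 :: "{distrib_lattice, bounded_lattice}"
begin

definition less_eq_S6 :: "S6 \<Rightarrow> S6 \<Rightarrow> bool" where
  "x \<le> y \<longleftrightarrow> x = y \<or> x = Zero \<or> y = One \<or> (x = Third \<and> y \<noteq> Zero) \<or> (y = TwoThirds \<and> x \<noteq> One)"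

definition less_S6 :: "S6 \<Rightarrow> S6 \<Rightarrow> bool" where
  "x < y \<longleftrightarrow> x \<le> y \<and> x \<noteq> y" for x y :: S6

text \<open>The only incomparable pair is \<open>N\<close>, \<open>B\<close>, with meet \<open>Third\<close> and join \<open>TwoThirds\<close>.\<close>

definition inf_S6 :: "S6 \<Rightarrow> S6 \<Rightarrow> S6" where
  "inf x y = (if x \<le> y then x else if y \<le> x then y else Third)"

definition sup_S6 :: "S6 \<Rightarrow> S6 \<Rightarrow> S6" where
  "sup x y = (if x \<le> y then y else if y \<le> x then x else TwoThirds)"

definition bot_S6 :: S6 where "bot = Zero"

definition top_S6 :: S6 where "top = One"

instance
proof
  fix x y z :: S6
  show "(x < y) = (x \<le> y \<and> \<not> y \<le> x)"
    by (cases x; cases y; simp add: less_S6_def less_eq_S6_def)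
  show "x \<le> x"
    by (simp add: less_eq_S6_def)
  show "x \<le> y \<Longrightarrow> y \<le> z \<Longrightarrow> x \<le> z"
    by (cases x; cases y; cases z; simp add: less_eq_S6_def)
  show "x \<le> y \<Longrightarrow> y \<le> x \<Longrightarrow> x = y"
    by (cases x; cases y; simp add: less_eq_S6_def)
  show "inf x y \<le> x" "inf x y \<le> y" "x \<le> sup x y" "y \<le> sup x y"
    by (cases x; cases y; simp add: less_eq_S6_def inf_S6_def sup_S6_def)+
  show "x \<le> y \<Longrightarrow> x \<le> z \<Longrightarrow> x \<le> inf y z"
    by (cases x; cases y; cases z; simp add: less_eq_S6_def inf_S6_def)
  show "y \<le> x \<Longrightarrow> z \<le> x \<Longrightarrow> sup y z \<le> x"
    by (cases x; cases y; cases z; simp add: less_eq_S6_def sup_S6_def)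
  show "bot \<le> x" "x \<le> top"
    by (simp_all add: less_eq_S6_def bot_S6_def top_S6_def)
  show "sup x (inf y z) = inf (sup x y) (sup x z)"
    by (cases x; cases y; cases z; simp add: less_eq_S6_def inf_S6_def sup_S6_def)
qed

end

fun neg :: "S6 \<Rightarrow> S6" where
  "neg Zero = One"
| "neg Third = TwoThirds"
| "neg N = N"
| "neg B = B"
| "neg TwoThirds = Third"
| "neg One = Zero"

definition nabla :: "S6 \<Rightarrow> S6" where
  "nabla x = (if x = Zero then Zero else One)"

definition hom :: "(fm \<Rightarrow> S6) \<Rightarrow> bool" where
  "hom h \<longleftrightarrow>
     h \<^bold>\<bottom> = Zero \<and> h \<^bold>\<top> = One \<and>
     (\<forall>\<alpha>. h (\<^bold>\<not> \<alpha>) = neg (h \<alpha>)) \<and>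
     (\<forall>\<alpha>. h (\<^bold>\<nabla> \<alpha>) = nabla (h \<alpha>)) \<and>
     (\<forall>\<alpha> \<beta>. h (\<alpha> \<^bold>\<and> \<beta>) = inf (h \<alpha>) (h \<beta>)) \<and>
     (\<forall>\<alpha> \<beta>. h (\<alpha> \<^bold>\<or> \<beta>) = sup (h \<alpha>) (h \<beta>))"

fun conj_list :: "fm list \<Rightarrow> fm" where
  "conj_list [] = \<^bold>\<top>"
| "conj_list [\<alpha>] = \<alpha>"
| "conj_list (\<alpha> # \<beta> # xs) = \<alpha> \<^bold>\<and> conj_list (\<beta> # xs)"

fun disj_list :: "fm list \<Rightarrow> fm" where
  "disj_list [] = \<^bold>\<bottom>"
| "disj_list [\<alpha>] = \<alpha>"
| "disj_list (\<alpha> # \<beta> # xs) = \<alpha> \<^bold>\<or> disj_list (\<beta> # xs)"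

text \<open>
  The formulas \<open>\<And>\<Gamma>\<close> and \<open>\<Or>\<Sigma>\<close> depend on an enumeration of the finite set, fixed here
  by choice; by \<open>hom_Conj\<close> and \<open>hom_Disj\<close> below, the enumeration does not affect
  the value under a homomorphism.
\<close>

definition Conj :: "fm fset \<Rightarrow> fm" where
  "Conj \<Gamma> = conj_list (SOME xs. distinct xs \<and> fset_of_list xs = \<Gamma>)"

definition Disj :: "fm fset \<Rightarrow> fm" where
  "Disj \<Sigma> = disj_list (SOME xs. distinct xs \<and> fset_of_list xs = \<Sigma>)"

lemma le_hom_conj_list:
  assumes "hom h"
  shows "x \<le> h (conj_list xs) \<longleftrightarrow> (\<forall>\<alpha>\<in>set xs. x \<le> h \<alpha>)"
proof -
  have "h \<^bold>\<top> = top" "\<And>\<alpha> \<beta>. h (\<alpha> \<^bold>\<and> \<beta>) = inf (h \<alpha>) (h \<beta>)"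
    using assms by (simp_all add: hom_def top_S6_def)
  then show ?thesis
    by (induction xs rule: conj_list.induct) simp_all
qed

lemma hom_disj_list_le:
  assumes "hom h"
  shows "h (disj_list xs) \<le> x \<longleftrightarrow> (\<forall>\<alpha>\<in>set xs. h \<alpha> \<le> x)"
proof -
  have "h \<^bold>\<bottom> = bot" "\<And>\<alpha> \<beta>. h (\<alpha> \<^bold>\<or> \<beta>) = sup (h \<alpha>) (h \<beta>)"
    using assms by (simp_all add: hom_def bot_S6_def)
  then show ?thesis
    by (induction xs rule: disj_list.induct) simp_all
qed

lemma enum_fset:
  "fset_of_list (SOME xs. distinct xs \<and> fset_of_list xs = \<Gamma>) = \<Gamma>"
proof -
  from finite_distinct_list[OF finite_fset[of \<Gamma>]] obtain xs where xs: "set xs = fset \<Gamma>" "distinct xs"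
    by (elim exE conjE)
  have "fset_of_list xs = \<Gamma>"
    by (rule fset_inject[THEN iffD1]) (simp only: fset_of_list.rep_eq xs(1))
  with xs(2) have "distinct xs \<and> fset_of_list xs = \<Gamma>" ..
  then have "\<exists>xs. distinct xs \<and> fset_of_list xs = \<Gamma>" ..
  then show ?thesis
    by (rule someI_ex[THEN conjunct2])
qed

lemma hom_Conj:
  assumes "hom h" "fset_of_list xs = \<Gamma>"
  shows "h (Conj \<Gamma>) = h (conj_list xs)"
proof -
  let ?ys = "SOME ys. distinct ys \<and> fset_of_list ys = \<Gamma>"
  have "set ?ys = set xs"
    unfolding fset_of_list.rep_eq[symmetric] enum_fset assms(2) ..
  then have eq: "x \<le> h (conj_list ?ys) \<longleftrightarrow> x \<le> h (conj_list xs)" for x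
    by (simp only: le_hom_conj_list[OF assms(1)])
  have "h (conj_list ?ys) = h (conj_list xs)"
    using eq[of "h (conj_list ?ys)"] eq[of "h (conj_list xs)"] by simp
  then show ?thesis
    by (simp only: Conj_def)
qed

lemma hom_Disj:
  assumes "hom h" "fset_of_list xs = \<Sigma>"
  shows "h (Disj \<Sigma>) = h (disj_list xs)"
proof -
  let ?ys = "SOME ys. distinct ys \<and> fset_of_list ys = \<Sigma>"
  have "set ?ys = set xs"
    unfolding fset_of_list.rep_eq[symmetric] enum_fset assms(2) ..
  then have eq: "h (disj_list ?ys) \<le> x \<longleftrightarrow> h (disj_list xs) \<le> x" for x
    by (simp only: hom_disj_list_le[OF assms(1)])
  have "h (disj_list ?ys) = h (disj_list xs)"
    using eq[of "h (disj_list ?ys)"] eq[of "h (disj_list xs)"] by simp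
  then show ?thesis
    by (simp only: Disj_def)
qed

datatype sequent = Sequent "fm fset" "fm fset" (infix \<open>\<Rrightarrow>\<close> 50)

fun valid :: "sequent \<Rightarrow> bool" where
  "valid (\<Gamma> \<Rrightarrow> \<Sigma>) \<longleftrightarrow> (\<forall>h. hom h \<longrightarrow> h (Conj \<Gamma>) \<le> h (Disj \<Sigma>))"

inductive derivable :: "sequent \<Rightarrow> bool" where
  ax_id: "derivable ({|\<alpha>|} \<Rrightarrow> {|\<alpha>|})"
| ax_bot: "derivable ({|\<^bold>\<bottom>|} \<Rrightarrow> {||})"
| ax_top: "derivable ({||} \<Rrightarrow> {|\<^bold>\<top>|})"
| ax_nabla: "derivable ({|\<alpha>|} \<Rrightarrow> {|\<^bold>\<nabla> \<alpha>|})"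
| ax_em: "derivable ({||} \<Rrightarrow> {|\<^bold>\<nabla> \<alpha> \<^bold>\<or> \<^bold>\<not> \<^bold>\<nabla> \<alpha>|})"
| weakL: "derivable (\<Gamma> \<Rrightarrow> \<Sigma>) \<Longrightarrow> derivable (finsert \<alpha> \<Gamma> \<Rrightarrow> \<Sigma>)"
| weakR: "derivable (\<Gamma> \<Rrightarrow> \<Sigma>) \<Longrightarrow> derivable (\<Gamma> \<Rrightarrow> finsert \<alpha> \<Sigma>)"
| cut: "derivable (\<Gamma> \<Rrightarrow> finsert \<alpha> \<Sigma>) \<Longrightarrow> derivable (finsert \<alpha> \<Gamma> \<Rrightarrow> \<Sigma>) \<Longrightarrow> derivable (\<Gamma> \<Rrightarrow> \<Sigma>)"
| andL: "derivable (finsert \<alpha> (finsert \<beta> \<Gamma>) \<Rrightarrow> \<Sigma>) \<Longrightarrow> derivable (finsert (\<alpha> \<^bold>\<and> \<beta>) \<Gamma> \<Rrightarrow> \<Sigma>)"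
| andR: "derivable (\<Gamma> \<Rrightarrow> finsert \<alpha> \<Sigma>) \<Longrightarrow> derivable (\<Gamma> \<Rrightarrow> finsert \<beta> \<Sigma>)
    \<Longrightarrow> derivable (\<Gamma> \<Rrightarrow> finsert (\<alpha> \<^bold>\<and> \<beta>) \<Sigma>)"
| orL: "derivable (finsert \<alpha> \<Gamma> \<Rrightarrow> \<Sigma>) \<Longrightarrow> derivable (finsert \<beta> \<Gamma> \<Rrightarrow> \<Sigma>)
    \<Longrightarrow> derivable (finsert (\<alpha> \<^bold>\<or> \<beta>) \<Gamma> \<Rrightarrow> \<Sigma>)"
| orR: "derivable (\<Gamma> \<Rrightarrow> finsert \<alpha> (finsert \<beta> \<Sigma>)) \<Longrightarrow> derivable (\<Gamma> \<Rrightarrow> finsert (\<alpha> \<^bold>\<or> \<beta>) \<Sigma>)"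
| neg: "derivable ({|\<alpha>|} \<Rrightarrow> {|\<beta>|}) \<Longrightarrow> derivable ({|\<^bold>\<not> \<beta>|} \<Rrightarrow> {|\<^bold>\<not> \<alpha>|})"
| negnegL: "derivable (finsert \<alpha> \<Gamma> \<Rrightarrow> \<Sigma>) \<Longrightarrow> derivable (finsert (\<^bold>\<not> \<^bold>\<not> \<alpha>) \<Gamma> \<Rrightarrow> \<Sigma>)"
| negnegR: "derivable (\<Gamma> \<Rrightarrow> finsert \<alpha> \<Sigma>) \<Longrightarrow> derivable (\<Gamma> \<Rrightarrow> finsert (\<^bold>\<not> \<^bold>\<not> \<alpha>) \<Sigma>)"
| nabla: "derivable (finsert \<alpha> \<Gamma> \<Rrightarrow> fimage Nabla \<Sigma>)
    \<Longrightarrow> derivable (finsert (\<^bold>\<nabla> \<alpha>) \<Gamma> \<Rrightarrow> fimage Nabla \<Sigma>)"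
| negnablaL: "derivable (finsert (\<^bold>\<not> \<^bold>\<nabla> \<alpha>) \<Gamma> \<Rrightarrow> \<Sigma>)
    \<Longrightarrow> derivable (finsert (\<^bold>\<nabla> \<^bold>\<not> \<^bold>\<nabla> \<alpha>) \<Gamma> \<Rrightarrow> \<Sigma>)"

end

theory Submission
  imports Defs
begin

text \<open>Induction on the derivation, checking each axiom and rule for a fixed homomorphism
  \<open>h\<close>. \<open>hom_Conj_finsert\<close> and \<open>hom_Disj_finsert\<close> turn a comma
  into a meet on the left and a join on the right, so each case becomes an inequality in the
  six-element algebra. Cut, \<open>orL\<close> and \<open>andR\<close> rest on distributivity. The
  delicate rule is \<open>nabla\<close>: its right side takes only the values \<open>Zero\<close>
  and \<open>One\<close> (\<open>hom_Disj_Nabla\<close>). At \<open>One\<close> nothing is to be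
  shown; at \<open>Zero\<close> one factor of the meet on the left is already \<open>Zero\<close>,
  and \<open>nabla\<close> keeps it so (\<open>inf_nabla_le_nabla\<close>).\<close>

lemma hom_Conj_fempty [simp]:
  assumes "hom h"
  shows "h (Conj {||}) = top"
  using hom_Conj[OF assms, of "[]" "{||}"] assms by (simp add: hom_def top_S6_def)

lemma hom_Disj_fempty [simp]:
  assumes "hom h"
  shows "h (Disj {||}) = bot"
  using hom_Disj[OF assms, of "[]" "{||}"] assms by (simp add: hom_def bot_S6_def)

lemma hom_Conj_finsert [simp]:
  assumes "hom h"
  shows "h (Conj (finsert \<alpha> \<Gamma>)) = inf (h \<alpha>) (h (Conj \<Gamma>))"
proof -
  obtain xs where xs: "fset_of_list xs = \<Gamma>"
    using enum_fset by blast
  \<comment> \<open>Here \<alpha> may already occur in \<open>xs\<close>; \<open>hom_Conj\<close>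
    allows enumerations with repetitions.\<close>
  then have "h (Conj (finsert \<alpha> \<Gamma>)) = h (conj_list (\<alpha> # xs))"
    by (intro hom_Conj[OF assms]) simp
  also have "\<dots> = inf (h \<alpha>) (h (conj_list xs))"
    \<comment> \<open>The split is needed because \<open>conj_list\<close> of a singleton carries no
      final \<open>Top\<close>; the values agree since \<open>top\<close> is neutral for
      \<open>inf\<close>.\<close>
    using assms by (cases xs) (simp_all add: hom_def flip: top_S6_def)
  finally show ?thesis
    by (simp add: hom_Conj[OF assms xs])
qed

lemma hom_Disj_finsert [simp]:
  assumes "hom h"
  shows "h (Disj (finsert \<alpha> \<Sigma>)) = sup (h \<alpha>) (h (Disj \<Sigma>))"
proof -
  obtain xs where xs: "fset_of_list xs = \<Sigma>"
    using enum_fset by blast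
  then have "h (Disj (finsert \<alpha> \<Sigma>)) = h (disj_list (\<alpha> # xs))"
    by (intro hom_Disj[OF assms]) simp
  also have "\<dots> = sup (h \<alpha>) (h (disj_list xs))"
    using assms by (cases xs) (simp_all add: hom_def flip: bot_S6_def)
  finally show ?thesis
    by (simp add: hom_Disj[OF assms xs])
qed

lemma hom_simps:
  assumes "hom h"
  shows "h \<^bold>\<bottom> = bot" "h \<^bold>\<top> = top"
    "h (\<^bold>\<not> \<alpha>) = neg (h \<alpha>)" "h (\<^bold>\<nabla> \<alpha>) = nabla (h \<alpha>)"
    "h (\<alpha> \<^bold>\<and> \<beta>) = inf (h \<alpha>) (h \<beta>)" "h (\<alpha> \<^bold>\<or> \<beta>) = sup (h \<alpha>) (h \<beta>)"
  using assms by (simp_all add: hom_def bot_S6_def top_S6_def)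

lemma neg_neg [simp]: "neg (neg x) = x"
  by (cases x) simp_all

lemma neg_antimono: "x \<le> y \<Longrightarrow> neg y \<le> neg x"
  by (cases x; cases y; simp add: less_eq_S6_def)

lemma le_nabla: "x \<le> nabla x"
  by (simp add: nabla_def less_eq_S6_def)

lemma nabla_em: "sup (nabla x) (neg (nabla x)) = top"
  by (simp add: nabla_def sup_S6_def less_eq_S6_def top_S6_def)

lemma nabla_neg_nabla: "nabla (neg (nabla x)) = neg (nabla x)"
  by (simp add: nabla_def)

lemma nabla_sup: "nabla (sup x y) = sup (nabla x) (nabla y)"
  by (cases x; cases y; simp add: nabla_def sup_S6_def less_eq_S6_def)

text \<open>Since \<open>Third\<close> is the only atom, a meet is \<open>Zero\<close> only if one of its arguments is.\<close>

lemma inf_nabla_le_nabla: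
  "inf x z \<le> nabla y \<Longrightarrow> inf (nabla x) z \<le> nabla y"
  by (cases x; cases z; simp add: nabla_def inf_S6_def less_eq_S6_def split: if_splits)

text \<open>The range of \<open>nabla\<close> contains \<open>bot\<close> and, by
  \<open>nabla_sup\<close>, is closed under joins. This brings the succedent of the rule
  \<open>nabla\<close> into the form that \<open>inf_nabla_le_nabla\<close> expects.\<close>

lemma hom_Disj_Nabla:
  assumes "hom h"
  shows "\<exists>y. h (Disj (fimage Nabla \<Sigma>)) = nabla y"
proof (induction \<Sigma>)
  case empty
  have "nabla Zero = bot"
    by (simp add: nabla_def bot_S6_def)
  then show ?case
    using assms by (intro exI[of _ Zero]) simp
next
  case (insert \<alpha> \<Sigma>)
  then show ?case
    using assms by (auto simp: hom_simps simp flip: nabla_sup)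
qed

text \<open>The algebraic content of cut: distributivity splits \<open>g\<close> into a part below
  \<open>a\<close> and a part below \<open>s\<close>, and the second premise puts the former below
  \<open>s\<close> as well.\<close>

lemma cut_distrib_lattice:
  fixes a g s :: "'a::distrib_lattice"
  assumes "g \<le> sup a s" "inf a g \<le> s"
  shows "g \<le> s"
proof -
  have "g = inf g (sup a s)"
    using assms(1) by (simp add: inf.absorb1)
  also have "\<dots> = sup (inf a g) (inf g s)"
    by (simp add: inf_sup_distrib1 inf_commute)
  also have "\<dots> \<le> s"
    using assms(2) by simp
  finally show ?thesis .
qed

lemma derivable_sound: "derivable S \<Longrightarrow> valid S"
proof (induction rule: derivable.induct)
  case (nabla \<alpha> \<Gamma> \<Sigma>)
  have "h (Conj (finsert (\<^bold>\<nabla> \<alpha>) \<Gamma>)) \<le> h (Disj (fimage Nabla \<Sigma>))" if h: "hom h" for h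
  proof -
    obtain y where "h (Disj (fimage Nabla \<Sigma>)) = nabla y"
      using hom_Disj_Nabla[OF h] by blast
    moreover from this have "inf (h \<alpha>) (h (Conj \<Gamma>)) \<le> nabla y"
      using nabla.IH h by (auto dest: spec[of _ h])
    ultimately show ?thesis
      using h by (simp add: hom_simps inf_nabla_le_nabla)
  qed
  then show ?case
    by simp
next
  case (cut \<Gamma> \<alpha> \<Sigma>)
  then show ?case
    by (auto intro: cut_distrib_lattice)
next
  \<comment> \<open>Distributing the meet over the join reduces the conclusion to the two premises;
    \<open>andR\<close> is dual.\<close>
  case (orL \<alpha> \<Gamma> \<Sigma> \<beta>)
  then show ?case
    by (simp add: hom_simps inf_sup_distrib2)
next
  case (andR \<Gamma> \<alpha> \<Sigma> \<beta>)
  then show ?case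
    by (simp add: hom_simps sup_inf_distrib2)
qed (simp_all add: hom_simps le_nabla nabla_em nabla_neg_nabla neg_antimono le_infI2 le_supI2
    inf_assoc sup_assoc)

theorem mainTheorem17:
  fixes \<Gamma> \<Sigma> :: "fm fset"
  assumes "derivable (\<Gamma> \<Rrightarrow> \<Sigma>)"
  shows "valid (\<Gamma> \<Rrightarrow> \<Sigma>)"
  using assms by (rule derivable_sound)

end
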